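(* Let $t\ge 0$ and $p\in[2,\infty)$. Assume that $$\lambda_s\ \ge\ \frac p4\,A_s+\frac{p(p+3)}4\,t\,B_s\qquad\text{for all } s\in[0,t].$$ Then for all $s\in[0,t]$ and all $f:S\to\mathbb R$: (i) $\|q_{s,t}f\|_{L^p(\mu_s)}\le 2^{1/4}\,\|f\|_{L^p(\mu_t)}$; (ii) $\|q_{s,t}f\|_{L^p(\mu_s)}\le \|f\|_{L^p(\mu_t)}+2^{1/4}\,\|f\|_{L^{p/2}(\mu_t)}$.
   Context: **Setting.** $S$ is a finite set. For $t\ge0$, $\mu_t(x)=\frac1{Z_t}e^{-\mathcal H_t(x)}\mu_0(x)$ are probability measures on $S$ with $\mu_t(x)>0$ for all $x\in S$, where $Z_t$ is a normalization constant and $(t,x)\mapsto\mathcal H_t(x)$ is a function on $[0,\infty)\times S$ that is continuously differentiable in $t$. Put $$H_t(x):=-\frac{\partial}{\partial t}\log\mu_t(x)=\frac{\partial}{\partial t}\mathcal H_t(x)-\int\frac{\partial}{\partial t}\mathcal H_t\,d\mu_t .$$ For each $t\ge0$, $\mathcal L_t=(\mathcal L_t(x,y))_{x,y\in S}$ is a $Q$-matrix (off-diagonal entries $\ge0$, row sums $0$), continuous in $t$, satisfying detailed balance $\mu_t(x)\mathcal L_t(x,y)=\mu_t(y)\mathcal L_t(y,x)$ for all $x,y\in S$; $(\mathcal L_tf)(x)=\sum_y\mathcal L_t(x,y)f(y)$. A continuous function $t\mapsto\lambda_t\in(0,\infty)$ is fixed. For $0\le s\le t$ and $f:S\to\mathbb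 R$, $q_{s,t}f:S\to\mathbb R$ is the unique solution of the backward equation $$-\frac{\partial}{\partial s}q_{s,t}f=\lambda_s\mathcal L_sq_{s,t}f-H_s\,q_{s,t}f,\quad s\in[0,t],\qquad q_{t,t}f=f.$$ **Norms.** $\|f\|_{L^p(\mu)}=\big(\sum_x|f(x)|^p\mu(x)\big)^{1/p}$. **Constants.** The Dirichlet form is $\mathcal E_t(f)=-\int f\,\mathcal L_tf\,d\mu_t=\frac12\sum_{x,y}(f(y)-f(x))^2\mathcal L_t(x,y)\mu_t(x)$. With $\mathcal K_t=\{f:S\to\mathbb R:\int f\,d\mu_t=0,\ f\not\equiv0\}$, set $$A_t:=\sup_{f\in\mathcal K_t}\frac{1}{\mathcal E_t(f)}\int(-H_t)f^2\,d\mu_t,\qquad B_t:=\sup_{f\in\mathcal K_t}\frac1{\mathcal E_t(f)}\Big|\int H_tf\,d\mu_t\Big|^2,$$ i.e. the optimal constants in $-\int H_t(f-\int f\,d\mu_t)^2d\mu_t\le A_t\mathcal E_t(f)$ and $|\int H_tf\,d\mu_t|^2\le B_t\mathcal E_t(f)$ for all $f:S\to\mathbb R$. These may be infinite. Conventions for degenerate cases: $a/0=+\infty,\,0,\,-\infty$ according to $a>0$, $a=0$, $a<0$; $\sup\emptyset=0$; $0\cdot\infty=0$; $-\infty+\infty=+\infty$; the assumed inequality fails if its right-hand side is $+\infty$. *)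

theory Defs
  imports "HOL-Analysis.Analysis"
begin

text \<open>
  The finite state space is the type \<open>'a :: finite\<close>; measures on it are given by their weights.
  Time-dependent objects are functions of a real argument that are only meaningful on
  \<open>{0..}\<close>. Time derivatives are therefore taken within \<open>{0..}\<close> (or \<open>{0..t}\<close>), i.e. they are
  one-sided at the end points.
\<close>

definition integ :: "('a::finite \<Rightarrow> real) \<Rightarrow> ('a \<Rightarrow> real) \<Rightarrow> real" where
  "integ m f = (\<Sum>x\<in>UNIV. f x * m x)"

definition Lp_norm :: "real \<Rightarrow> ('a::finite \<Rightarrow> real) \<Rightarrow> ('a \<Rightarrow> real) \<Rightarrow> real" where
  "Lp_norm p m f = (\<Sum>x\<in>UNIV. \<bar>f x\<bar> powr p * m x) powr (1 / p)"

definition gen_apply :: "('a::finite \<Rightarrow> 'a \<Rightarrow> real) \<Rightarrow> ('a \<Rightarrow> real) \<Rightarrow> 'a \<Rightarrow> real" where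
  "gen_apply L f x = (\<Sum>y\<in>UNIV. L x y * f y)"

definition Q_matrix :: "('a::finite \<Rightarrow> 'a \<Rightarrow> real) \<Rightarrow> bool" where
  "Q_matrix L \<longleftrightarrow> (\<forall>x y. x \<noteq> y \<longrightarrow> 0 \<le> L x y) \<and> (\<forall>x. (\<Sum>y\<in>UNIV. L x y) = 0)"

definition detailed_balance :: "('a::finite \<Rightarrow> real) \<Rightarrow> ('a \<Rightarrow> 'a \<Rightarrow> real) \<Rightarrow> bool" where
  "detailed_balance m L \<longleftrightarrow> (\<forall>x y. m x * L x y = m y * L y x)"

locale annealing_setting =
  fixes \<mu> :: "real \<Rightarrow> 'a::finite \<Rightarrow> real"
    and Z :: "real \<Rightarrow> real"
    and \<H> :: "real \<Rightarrow> 'a \<Rightarrow> real"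
    and \<L> :: "real \<Rightarrow> 'a \<Rightarrow> 'a \<Rightarrow> real"
    and lam :: "real \<Rightarrow> real"
  assumes \<mu>_eq: "0 \<le> t \<Longrightarrow> \<mu> t x = (1 / Z t) * exp (- \<H> t x) * \<mu> 0 x"
    and \<mu>_pos: "0 \<le> t \<Longrightarrow> 0 < \<mu> t x"
    and \<mu>_prob: "0 \<le> t \<Longrightarrow> (\<Sum>x\<in>UNIV. \<mu> t x) = 1"
    and \<H>_C1: "\<exists>D. (\<forall>t\<ge>0. ((\<lambda>r. \<H> r x) has_real_derivative D t) (at t within {0..}))
                   \<and> continuous_on {0..} D"
    and \<L>_Q: "0 \<le> t \<Longrightarrow> Q_matrix (\<L> t)"
    and \<L>_cont: "continuous_on {0..} (\<lambda>t. \<L> t x y)"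
    and \<L>_db: "0 \<le> t \<Longrightarrow> detailed_balance (\<mu> t) (\<L> t)"
    and lam_pos: "0 \<le> t \<Longrightarrow> 0 < lam t"
    and lam_cont: "continuous_on {0..} lam"

definition H_deriv :: "(real \<Rightarrow> 'a::finite \<Rightarrow> real) \<Rightarrow> real \<Rightarrow> 'a \<Rightarrow> real" where
  "H_deriv \<mu> t x = - vector_derivative (\<lambda>r. ln (\<mu> r x)) (at t within {0..})"

definition backward_solution ::
  "(real \<Rightarrow> 'a::finite \<Rightarrow> real) \<Rightarrow> (real \<Rightarrow> 'a \<Rightarrow> 'a \<Rightarrow> real) \<Rightarrow> (real \<Rightarrow> real) \<Rightarrow>
    real \<Rightarrow> ('a \<Rightarrow> real) \<Rightarrow> (real \<Rightarrow> 'a \<Rightarrow> real) \<Rightarrow> bool" where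
  "backward_solution \<mu> \<L> lam t f u \<longleftrightarrow>
     (\<forall>s\<in>{0..t}. \<forall>x. ((\<lambda>r. u r x) has_real_derivative
        - (lam s * gen_apply (\<L> s) (u s) x - H_deriv \<mu> s x * u s x)) (at s within {0..t})) \<and>
     u t = f"

definition dirichlet_form :: "('a::finite \<Rightarrow> real) \<Rightarrow> ('a \<Rightarrow> 'a \<Rightarrow> real) \<Rightarrow> ('a \<Rightarrow> real) \<Rightarrow> real"
  where "dirichlet_form m L f = - integ m (\<lambda>x. f x * gen_apply L f x)"

definition mean_zero_nontrivial :: "('a::finite \<Rightarrow> real) \<Rightarrow> ('a \<Rightarrow> real) set" where
  "mean_zero_nontrivial m = {f. integ m f = 0 \<and> f \<noteq> (\<lambda>x. 0)}"

text \<open>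
  The quotients below must be formed in \<^typ>\<open>ereal\<close>: there \<open>a / 0\<close> is \<open>\<infinity>\<close>, \<open>0\<close> or \<open>-\<infinity>\<close>
  according to the sign of \<open>a\<close>, whereas \<open>a / 0 = 0\<close> in \<^typ>\<open>real\<close>. Likewise \<open>0 * \<infinity> = 0\<close> and
  \<open>-\<infinity> + \<infinity> = \<infinity>\<close> hold in \<^typ>\<open>ereal\<close>. The supremum of the empty set, which occurs exactly for a
  one-point state space, is \<open>-\<infinity>\<close> in \<^typ>\<open>ereal\<close> and is replaced by \<open>0\<close>.
\<close>

definition sup0 :: "ereal set \<Rightarrow> ereal" where
  "sup0 X = (if X = {} then 0 else Sup X)"

definition const_A ::
  "(real \<Rightarrow> 'a::finite \<Rightarrow> real) \<Rightarrow> (real \<Rightarrow> 'a \<Rightarrow> 'a \<Rightarrow> real) \<Rightarrow> real \<Rightarrow> ereal" where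
  "const_A \<mu> \<L> t =
     sup0 ((\<lambda>f. ereal (integ (\<mu> t) (\<lambda>x. - H_deriv \<mu> t x * (f x)\<^sup>2))
                  / ereal (dirichlet_form (\<mu> t) (\<L> t) f)) ` mean_zero_nontrivial (\<mu> t))"

definition const_B ::
  "(real \<Rightarrow> 'a::finite \<Rightarrow> real) \<Rightarrow> (real \<Rightarrow> 'a \<Rightarrow> 'a \<Rightarrow> real) \<Rightarrow> real \<Rightarrow> ereal" where
  "const_B \<mu> \<L> t =
     sup0 ((\<lambda>f. ereal (\<bar>integ (\<mu> t) (\<lambda>x. H_deriv \<mu> t x * f x)\<bar>\<^sup>2)
                  / ereal (dirichlet_form (\<mu> t) (\<L> t) f)) ` mean_zero_nontrivial (\<mu> t))"

lemma ereal_conventions: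
  "a > 0 \<Longrightarrow> ereal a / ereal 0 = \<infinity>" "ereal 0 / ereal 0 = 0" "a < 0 \<Longrightarrow> ereal a / ereal 0 = -\<infinity>"
  "(0::ereal) * \<infinity> = 0" "-\<infinity> + (\<infinity>::ereal) = \<infinity>" "(\<infinity>::ereal) + -\<infinity> = \<infinity>"
  "\<not> ereal a \<ge> \<infinity>"
  by (auto simp: divide_ereal_def)

end

theory Submission
  imports Defs
begin

text \<open>
  Write \<open>q\<^sub>s\<close> for the solution, \<open>\<Phi>\<^sub>r(s) = \<integral>|q\<^sub>s|\<^sup>r d\<mu>\<^sub>s\<close>
  and \<open>h = |q\<^sub>s| powr (r/2)\<close>. Differentiating and applying the Stroock--Varopoulos inequality
  to the generator term gives, for \<open>1 < r \<le> p\<close>,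
  \<open>\<Phi>\<^sub>r' \<ge> (r - 1) (4/r \<lambda>\<^sub>s \<E>\<^sub>s(h) + \<integral>H\<^sub>s h\<^sup>2 d\<mu>\<^sub>s)\<close>.
  Splitting \<open>h\<close> into its mean \<open>\<Phi>\<^bsub>r/2\<^esub>\<close> and a centred part, the hypothesis on \<open>\<lambda>\<^sub>s\<close> and
  AM-GM bound the bracket from below by \<open>-\<Phi>\<^bsub>r/2\<^esub>\<^sup>2 / ((r + 3) t)\<close>.

  As \<open>\<Phi>\<^bsub>r/2\<^esub>\<^sup>2 \<le> \<Phi>\<^sub>r\<close>, Gronwall yields \<open>\<Phi>\<^sub>r(s) \<le> exp ((r - 1)/(r + 3)) \<Phi>\<^sub>r(t)\<close>, and
  \<open>(r - 1)/(r (r + 3)) \<le> 1/6 \<le> ln 2 / 4\<close> gives (i) with \<open>r = p\<close>. The same bound with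
  \<open>r = p/2\<close> (through the limit \<open>r \<rightarrow> 1\<close> if \<open>p = 2\<close>), inserted into the differential
  inequality for \<open>\<Phi>\<^sub>p\<close>, gives (ii) by integration.
\<close>

section \<open>The Stroock--Varopoulos inequality\<close>

text \<open>Convexity of \<open>sinh\<close> on the nonnegative half-line with
  \<open>sinh 0 = 0\<close>, obtained from monotonicity of \<open>cosh\<close> there.\<close>

lemma sinh_mult_le:
  fixes \<theta> z :: real
  assumes "0 \<le> \<theta>" "\<theta> \<le> 1" "0 \<le> z"
  shows "sinh (\<theta> * z) \<le> \<theta> * sinh z"
proof -
  let ?g = "\<lambda>z. \<theta> * sinh z - sinh (\<theta> * z)"
  have "?g 0 \<le> ?g z"
  proof (rule DERIV_nonneg_imp_nondecreasing[OF assms(3)])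
    fix y assume y: "0 \<le> y" "y \<le> z"
    have "(?g has_real_derivative \<theta> * (cosh y - cosh (\<theta> * y))) (at y)"
      by (auto intro!: derivative_eq_intros simp: algebra_simps)
    moreover have "cosh (\<theta> * y) \<le> cosh y"
      using assms y by (simp add: cosh_real_nonneg_le_iff mult_left_le_one_le)
    ultimately show "\<exists>D. (?g has_real_derivative D) (at y) \<and> 0 \<le> D"
      using assms by (metis diff_ge_0_iff_ge mult_nonneg_nonneg)
  qed
  then show ?thesis by simp
qed

lemma sinh_mult_sq_le:
  fixes \<theta> z :: real
  assumes "\<bar>\<theta>\<bar> \<le> 1"
  shows "(sinh (\<theta> * z))\<^sup>2 \<le> \<theta>\<^sup>2 * (sinh z)\<^sup>2"
proof -
  have "sinh (\<bar>\<theta>\<bar> * \<bar>z\<bar>) \<le> \<bar>\<theta>\<bar> * sinh \<bar>z\<bar>"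
    using assms by (intro sinh_mult_le) auto
  then have "\<bar>sinh (\<theta> * z)\<bar> \<le> \<bar>\<theta> * sinh z\<bar>"
    by (simp add: abs_mult flip: sinh_real_abs)
  then show ?thesis
    by (simp add: abs_le_square_iff power_mult_distrib)
qed

text \<open>Pull out the geometric mean of the two exponentials. The prefactor depends on
  \<open>\<alpha> + \<beta>\<close> only, so pairs with equal sums can be compared through
  \<open>sinh\<close> alone.\<close>

lemma exp_half_diff_sq:
  fixes \<alpha> \<beta> :: real
  shows "(exp (\<alpha>/2) - exp (\<beta>/2))\<^sup>2 = 4 * exp ((\<alpha>+\<beta>)/2) * (sinh ((\<alpha>-\<beta>)/4))\<^sup>2"
proof -
  have "exp (\<alpha>/2) - exp (\<beta>/2) = 2 * exp ((\<alpha>+\<beta>)/4) * sinh ((\<alpha>-\<beta>)/4)"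
  proof -
    have "exp (\<alpha>/2) = exp ((\<alpha>+\<beta>)/4) * exp ((\<alpha>-\<beta>)/4)"
      by (simp add: field_simps flip: exp_add)
    moreover have "exp (\<beta>/2) = exp ((\<alpha>+\<beta>)/4) * exp (- ((\<alpha>-\<beta>)/4))"
      by (simp add: field_simps flip: exp_add)
    ultimately show ?thesis
      by (simp add: sinh_field_def right_diff_distrib)
  qed
  then show ?thesis
    by (simp add: power_mult_distrib flip: exp_of_nat_mult)
qed

text \<open>The odd extension of the power; \<open>r * signed_powr (r - 1) x\<close> is the
  derivative of \<open>\<bar>x\<bar> powr r\<close>.\<close>

definition signed_powr :: "real \<Rightarrow> real \<Rightarrow> real" where
  "signed_powr e x = sgn x * \<bar>x\<bar> powr e"

lemma mult_signed_powr: "x * signed_powr (r - 1) x = \<bar>x\<bar> powr r"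
proof (cases "x = 0")
  case False
  have "x * signed_powr (r - 1) x = \<bar>x\<bar> powr 1 * \<bar>x\<bar> powr (r - 1)"
    by (simp add: signed_powr_def sgn_if)
  also have "\<dots> = \<bar>x\<bar> powr r"
    by (subst powr_add[symmetric]) simp
  finally show ?thesis .
qed (simp add: signed_powr_def)

text \<open>At 0 the difference quotient is at most \<open>\<bar>h\<bar> powr (r - 1)\<close> in
  modulus, which tends to 0 because \<open>1 < r\<close>. Elsewhere the modulus is locally linear
  and the chain rule applies.\<close>

lemma has_real_derivative_abs_powr:
  assumes r: "1 < r"
  shows "((\<lambda>x. \<bar>x\<bar> powr r) has_real_derivative r * signed_powr (r - 1) x) (at x)"
proof (cases "x = 0")
  case False
  have "((\<lambda>x. \<bar>x\<bar>) has_real_derivative sgn x) (at x)"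
  proof (rule has_field_derivative_transform_within_open)
    show "((\<lambda>y. sgn x * y) has_real_derivative sgn x) (at x)"
      by (auto intro!: derivative_eq_intros)
    show "open (if 0 < x then {0<..} else {..<0::real})"
      by simp
  qed (use False in \<open>auto simp: sgn_if split: if_splits\<close>)
  from DERIV_fun_powr[OF this, of r] False show ?thesis
    by (simp add: signed_powr_def ac_simps)
next
  case True
  have "((\<lambda>h. \<bar>h\<bar> powr r / h) \<longlongrightarrow> 0) (at 0)"
  proof (rule Lim_null_comparison)
    show "\<forall>\<^sub>F h in at 0. norm (\<bar>h\<bar> powr r / h) \<le> \<bar>h\<bar> powr (r - 1)"
      by (rule always_eventually) (auto simp: powr_diff)
    show "((\<lambda>h::real. \<bar>h\<bar> powr (r - 1)) \<longlongrightarrow> 0) (at 0)"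
      using r by (auto intro!: tendsto_eq_intros)
  qed
  then show ?thesis
    using True r by (simp add: signed_powr_def has_field_derivative_iff)
qed

lemma Stroock_Varopoulos_pos:
  fixes a b r :: real
  assumes r: "1 < r" and "0 < a" "0 < b"
  shows "4 * (r - 1) / r\<^sup>2 * (a powr (r/2) - b powr (r/2))\<^sup>2
    \<le> (a - b) * (a powr (r - 1) - b powr (r - 1))"
proof -
  \<comment> \<open>In the variables \<open>u\<close>, \<open>v\<close>, \<open>y\<close>, \<open>\<theta>\<close> the claim becomes \<open>(sinh (\<theta> y))\<^sup>2 \<le> \<theta>\<^sup>2 (sinh y)\<^sup>2\<close>.\<close>
  define u v where "u = ln a" and "v = ln b"
  have ab: "a = exp u" "b = exp v"
    using assms by (auto simp: u_def v_def)
  define P where "P = 4 * exp (r * (u + v) / 2)"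
  define y \<theta> where "y = r * (u - v) / 4" and "\<theta> = (r - 2) / r"
  have X: "(a powr (r/2) - b powr (r/2))\<^sup>2 = P * (sinh y)\<^sup>2"
    using exp_half_diff_sq[of "r * u" "r * v"]
    by (simp add: ab powr_def P_def y_def algebra_simps)
  have Y: "(exp ((u + (r - 1) * v) / 2) - exp ((v + (r - 1) * u) / 2))\<^sup>2 = P * (sinh (\<theta> * y))\<^sup>2"
  proof -
    have "(u + (r - 1) * v - (v + (r - 1) * u)) / 4 = - (\<theta> * y)"
      using r by (simp add: \<theta>_def y_def field_simps)
    moreover have "(u + (r - 1) * v + (v + (r - 1) * u)) / 2 = r * (u + v) / 2"
      by (simp add: algebra_simps)
    ultimately show ?thesis
      using exp_half_diff_sq[of "u + (r - 1) * v" "v + (r - 1) * u"]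
      by (simp only: P_def sinh_minus power2_minus)
  qed
  have sq: "(exp (c/2))\<^sup>2 = exp c" for c :: real
    by (simp flip: exp_of_nat_mult)
  \<comment> \<open>Both pairs of exponents have the sum \<open>r * (u + v) / 2\<close>, so the
    cross terms of the two squares cancel, leaving the four exponentials of the product.\<close>
  have "(a - b) * (a powr (r - 1) - b powr (r - 1)) =
      (a powr (r/2) - b powr (r/2))\<^sup>2
      - (exp ((u + (r - 1) * v) / 2) - exp ((v + (r - 1) * u) / 2))\<^sup>2"
  proof -
    have [simp]: "(exp (r * c / 2))\<^sup>2 = exp (r * c)" for c :: real
      using sq[of "r * c"] by simp
    have "exp (r * u / 2) * exp (r * v / 2) =
          exp ((u + (r - 1) * v) / 2) * exp ((v + (r - 1) * u) / 2)"
      by (simp add: algebra_simps add_divide_distrib diff_divide_distrib flip: exp_add)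
    moreover have "(exp u - exp v) * (exp ((r - 1) * u) - exp ((r - 1) * v)) =
      exp (r * u) + exp (r * v) - exp (u + (r - 1) * v) - exp (v + (r - 1) * u)"
      by (simp add: algebra_simps flip: exp_add)
    ultimately show ?thesis
      by (simp add: ab powr_def power2_diff sq)
  qed
  also have "\<dots> = P * ((sinh y)\<^sup>2 - (sinh (\<theta> * y))\<^sup>2)"
    by (simp only: X Y right_diff_distrib)
  also have "\<dots> \<ge> P * ((sinh y)\<^sup>2 - \<theta>\<^sup>2 * (sinh y)\<^sup>2)"
    using r by (intro mult_left_mono diff_left_mono sinh_mult_sq_le)
      (auto simp: P_def \<theta>_def abs_le_iff field_simps)
  also have "P * ((sinh y)\<^sup>2 - \<theta>\<^sup>2 * (sinh y)\<^sup>2) = (1 - \<theta>\<^sup>2) * (P * (sinh y)\<^sup>2)"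
    by (simp add: algebra_simps)
  also have "1 - \<theta>\<^sup>2 = 4 * (r - 1) / r\<^sup>2"
    using r by (simp add: \<theta>_def field_simps power2_eq_square)
  finally show ?thesis by (simp add: X)
qed

text \<open>Equal signs reduce to the positive case by oddness. Otherwise the cross terms only
  enlarge the right side, which is then at least
  \<open>\<bar>a\<bar> powr r + \<bar>b\<bar> powr r\<close>, while the constant on the left is at
  most 1 by \<open>(r - 2)\<^sup>2 \<ge> 0\<close>.\<close>

lemma Stroock_Varopoulos:
  fixes a b r :: real
  assumes r: "1 < r"
  shows "4 * (r - 1) / r\<^sup>2 * (\<bar>a\<bar> powr (r/2) - \<bar>b\<bar> powr (r/2))\<^sup>2
    \<le> (a - b) * (signed_powr (r - 1) a - signed_powr (r - 1) b)"
proof -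
  consider "a > 0" "b > 0" | "a < 0" "b < 0" | "a * b \<le> 0"
    by (cases a "0::real" rule: linorder_cases; cases b "0::real" rule: linorder_cases)
      (auto simp: mult_le_0_iff)
  then show ?thesis
  proof cases
    case 1
    then show ?thesis
      using Stroock_Varopoulos_pos[OF r 1] by (simp add: signed_powr_def)
  next
    case 2
    then show ?thesis
      using Stroock_Varopoulos_pos[OF r, of "-a" "-b"]
      by (simp add: signed_powr_def algebra_simps)
  next
    case 3
    have neg: "a * signed_powr e b \<le> 0" "b * signed_powr e a \<le> 0" for e
      using 3 by (auto simp: signed_powr_def sgn_if mult_le_0_iff split: if_splits)
    have sq: "(\<bar>c\<bar> powr (r/2))\<^sup>2 = \<bar>c\<bar> powr r" for c
      by (simp add: power2_eq_square flip: powr_add)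
    have "4 * (r - 1) / r\<^sup>2 \<le> 1"
      using r sum_power2_ge_zero[of "r - 2" 0]
      by (simp add: power2_eq_square algebra_simps)
    then have "4 * (r - 1) / r\<^sup>2 * (\<bar>a\<bar> powr (r/2) - \<bar>b\<bar> powr (r/2))\<^sup>2
        \<le> (\<bar>a\<bar> powr (r/2) - \<bar>b\<bar> powr (r/2))\<^sup>2"
      using r by (intro mult_left_le_one_le) auto
    also have "\<dots> \<le> \<bar>a\<bar> powr r + \<bar>b\<bar> powr r"
      by (simp add: power2_diff sq)
    also have "\<dots> \<le> (a - b) * (signed_powr (r - 1) a - signed_powr (r - 1) b)"
      using neg[of "r - 1"] mult_signed_powr[of a r] mult_signed_powr[of b r]
      by (simp add: algebra_simps)
    finally show ?thesis .
  qed
qed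

section \<open>Reversible generators and their Dirichlet forms\<close>

text \<open>Detailed balance makes the weight \<open>m x * L x y\<close> symmetric, and zero row
  sums kill the terms depending on one variable only. In the application \<open>g\<close> is a
  signed power of \<open>f\<close>.\<close>

lemma integ_gen_apply_symmetrized:
  fixes L :: "'a::finite \<Rightarrow> 'a \<Rightarrow> real"
  assumes Q: "Q_matrix L" and db: "detailed_balance m L"
  shows "- integ m (\<lambda>x. g x * gen_apply L f x)
    = (\<Sum>x\<in>UNIV. \<Sum>y\<in>UNIV. (g y - g x) * (f y - f x) * (m x * L x y)) / 2"
proof -
  let ?S = "\<lambda>F. \<Sum>x\<in>UNIV. \<Sum>y\<in>UNIV. F x y * (m x * L x y)"
  have swap: "?S F = ?S (\<lambda>x y. F y x)" for F
  proof -
    have "?S F = (\<Sum>y\<in>UNIV. \<Sum>x\<in>UNIV. F x y * (m x * L x y))"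
      by (rule sum.swap)
    also have "\<dots> = ?S (\<lambda>x y. F y x)"
      using db by (intro sum.cong refl) (simp add: detailed_balance_def)
    finally show ?thesis .
  qed
  have zero: "?S (\<lambda>x y. F x) = 0" for F :: "'a \<Rightarrow> real"
  proof -
    have "?S (\<lambda>x y. F x) = (\<Sum>x\<in>UNIV. F x * m x * (\<Sum>y\<in>UNIV. L x y))"
      by (simp add: sum_distrib_left mult.assoc)
    then show ?thesis using Q by (simp add: Q_matrix_def)
  qed
  have "?S (\<lambda>x y. (g y - g x) * (f y - f x))
      = ?S (\<lambda>x y. g y * f y) - ?S (\<lambda>x y. g y * f x) - ?S (\<lambda>x y. g x * f y) + ?S (\<lambda>x y. g x * f x)"
    by (simp add: algebra_simps sum.distrib sum_subtractf)
  also have "?S (\<lambda>x y. g y * f y) = 0"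
    using swap[of "\<lambda>x y. g y * f y"] zero[of "\<lambda>x. g x * f x"] by simp
  also have "?S (\<lambda>x y. g x * f x) = 0"
    using zero[of "\<lambda>x. g x * f x"] by simp
  also have "?S (\<lambda>x y. g y * f x) = ?S (\<lambda>x y. g x * f y)"
    by (rule swap)
  also have "?S (\<lambda>x y. g x * f y) = integ m (\<lambda>x. g x * gen_apply L f x)"
    by (simp add: integ_def gen_apply_def sum_distrib_left sum_distrib_right ac_simps)
  finally show ?thesis by simp
qed

lemma dirichlet_form_symmetrized:
  fixes L :: "'a::finite \<Rightarrow> 'a \<Rightarrow> real"
  assumes "Q_matrix L" "detailed_balance m L"
  shows "dirichlet_form m L f
    = (\<Sum>x\<in>UNIV. \<Sum>y\<in>UNIV. (f y - f x)\<^sup>2 * (m x * L x y)) / 2"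
  using integ_gen_apply_symmetrized[OF assms, of f f]
  by (simp add: dirichlet_form_def power2_eq_square)

text \<open>The diagonal of a Q-matrix is nonpositive, so a termwise comparison needs kernels that
  vanish there.\<close>

lemma off_diag_mono:
  fixes L :: "'a::finite \<Rightarrow> 'a \<Rightarrow> real"
  assumes "Q_matrix L" "\<And>x. 0 \<le> m x" "\<And>x y. F x y \<le> G x y" "\<And>x. F x x = 0" "\<And>x. G x x = 0"
  shows "(\<Sum>x\<in>UNIV. \<Sum>y\<in>UNIV. F x y * (m x * L x y)) \<le> (\<Sum>x\<in>UNIV. \<Sum>y\<in>UNIV. G x y * (m x * L x y))"
proof (intro sum_mono)
  fix x y
  show "F x y * (m x * L x y) \<le> G x y * (m x * L x y)"
    using assms by (cases "x = y") (auto simp: Q_matrix_def intro!: mult_right_mono)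
qed

lemma dirichlet_form_nonneg:
  fixes L :: "'a::finite \<Rightarrow> 'a \<Rightarrow> real"
  assumes "Q_matrix L" "detailed_balance m L" "\<And>x. 0 \<le> m x"
  shows "0 \<le> dirichlet_form m L f"
  using off_diag_mono[OF assms(1,3), of "\<lambda>_ _. 0" "\<lambda>x y. (f y - f x)\<^sup>2"]
  by (simp add: dirichlet_form_symmetrized[OF assms(1,2)])

lemma dirichlet_form_shift:
  fixes L :: "'a::finite \<Rightarrow> 'a \<Rightarrow> real"
  assumes "Q_matrix L" "detailed_balance m L"
  shows "dirichlet_form m L (\<lambda>x. f x - c) = dirichlet_form m L f"
  by (simp add: dirichlet_form_symmetrized[OF assms])

lemma dirichlet_form_Stroock_Varopoulos:
  fixes L :: "'a::finite \<Rightarrow> 'a \<Rightarrow> real"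
  assumes L: "Q_matrix L" "detailed_balance m L" and m: "\<And>x. 0 \<le> m x" and r: "1 < r"
  shows "4 * (r - 1) / r\<^sup>2 * dirichlet_form m L (\<lambda>x. \<bar>f x\<bar> powr (r/2))
    \<le> - integ m (\<lambda>x. signed_powr (r - 1) (f x) * gen_apply L f x)"
proof -
  let ?h = "\<lambda>x. \<bar>f x\<bar> powr (r/2)" and ?g = "\<lambda>x. signed_powr (r - 1) (f x)"
  have "(\<Sum>x\<in>UNIV. \<Sum>y\<in>UNIV. (4 * (r - 1) / r\<^sup>2 * (?h y - ?h x)\<^sup>2) * (m x * L x y))
      \<le> (\<Sum>x\<in>UNIV. \<Sum>y\<in>UNIV. ((?g y - ?g x) * (f y - f x)) * (m x * L x y))"
    using Stroock_Varopoulos[OF r]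
    by (intro off_diag_mono[OF L(1) m]) (auto simp: mult.commute)
  then show ?thesis
    by (simp only: integ_gen_apply_symmetrized[OF L] dirichlet_form_symmetrized[OF L]
        mult.assoc flip: sum_distrib_left) simp
qed


section \<open>Real-valued functional inequalities\<close>

text \<open>If \<open>e = 0\<close>, a positive \<open>n\<close> would make the quotient infinite,
  so \<open>n \<le> 0\<close>.\<close>

lemma ereal_divide_le_imp_le_mult:
  fixes n e a :: real
  assumes "ereal n / ereal e \<le> ereal a" "0 \<le> e"
  shows "n \<le> a * e"
proof (cases "e = 0")
  case True
  then have "\<not> 0 < n"
    using assms(1) ereal_conventions(1)[of n] by auto
  then show ?thesis using True by simp
next
  case False
  then have "n / e \<le> a" using assms(1) by simp
  then show ?thesis using False assms(2) by (simp add: field_simps)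
qed

lemma sup0_upper: "x \<in> X \<Longrightarrow> x \<le> sup0 X"
  by (auto simp: sup0_def intro: Sup_upper)

text \<open>Trades the possibly infinite suprema for real constants. Neither is
  \<open>\<infinity>\<close>: a sum with a summand \<open>\<infinity>\<close> is
  \<open>\<infinity>\<close>, even if the other one is \<open>-\<infinity>\<close>, and exceeds the
  real \<open>l\<close>.\<close>

lemma sup0_divide_imp_real_bounds:
  fixes N\<^sub>1 N\<^sub>2 e :: "'b \<Rightarrow> real"
  assumes e: "\<And>f. f \<in> K \<Longrightarrow> 0 \<le> e f" and N: "\<And>f. f \<in> K \<Longrightarrow> 0 \<le> N\<^sub>2 f"
    and cd: "0 < c" "0 < d"
    and le: "ereal c * sup0 ((\<lambda>f. ereal (N\<^sub>1 f) / ereal (e f)) ` K)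
           + ereal d * sup0 ((\<lambda>f. ereal (N\<^sub>2 f) / ereal (e f)) ` K) \<le> ereal l"
  shows "\<exists>a b. 0 \<le> b \<and> c * a + d * b \<le> l \<and> (\<forall>f\<in>K. N\<^sub>1 f \<le> a * e f \<and> N\<^sub>2 f \<le> b * e f)"
proof -
  define A where "A = sup0 ((\<lambda>f. ereal (N\<^sub>1 f) / ereal (e f)) ` K)"
  define B where "B = sup0 ((\<lambda>f. ereal (N\<^sub>2 f) / ereal (e f)) ` K)"
  have le': "ereal c * A + ereal d * B \<le> ereal l"
    using le by (simp add: A_def B_def)
  have A: "ereal (N\<^sub>1 f) / ereal (e f) \<le> A" if "f \<in> K" for f
    unfolding A_def by (rule sup0_upper, rule image_eqI[OF _ that], rule refl)
  have B: "ereal (N\<^sub>2 f) / ereal (e f) \<le> B" if "f \<in> K" for f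
    unfolding B_def by (rule sup0_upper, rule image_eqI[OF _ that], rule refl)
  \<comment> \<open>For empty \<open>K\<close> this rests on the value 0 of \<open>sup0\<close>;
    otherwise every quotient is nonnegative.\<close>
  have "0 \<le> B"
  proof (cases "K = {}")
    case True
    then show ?thesis by (simp add: B_def sup0_def)
  next
    case False
    then obtain f where f: "f \<in> K" by blast
    have "0 \<le> ereal (N\<^sub>2 f) / ereal (e f)"
      using e[OF f] N[OF f] by (cases "e f = 0") (auto simp: divide_ereal_def)
    with B[OF f] show ?thesis by (rule order_trans[rotated])
  qed
  moreover have "B \<noteq> \<infinity>" "A \<noteq> \<infinity>"
    using le' cd by auto
  ultimately obtain b where b: "B = ereal b" "0 \<le> b"
    by (cases B) auto
  \<comment> \<open>\<open>A = -\<infinity>\<close> is possible, namely when every \<open>e f\<close> vanishes; then any \<open>a\<close> will do.\<close>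
  obtain a where a: "A \<le> ereal a" "c * a + d * b \<le> l"
  proof (cases A)
    case (real a)
    then show ?thesis using le' b that[of a] by simp
  next
    case MInf
    then show ?thesis using cd that[of "(l - d * b) / c"] by simp
  qed (use \<open>A \<noteq> \<infinity>\<close> in simp)
  show ?thesis
  proof (rule exI[of _ a], rule exI[of _ b], intro conjI ballI)
    fix f assume f: "f \<in> K"
    show "N\<^sub>1 f \<le> a * e f"
      using order_trans[OF A[OF f] a(1)] e[OF f] by (rule ereal_divide_le_imp_le_mult)
    show "N\<^sub>2 f \<le> b * e f"
      using B[OF f] e[OF f] unfolding b(1) by (rule ereal_divide_le_imp_le_mult)
  qed (use a b in auto)
qed

section \<open>Integrals against weights; splitting into mean and centred part\<close>

lemma integ_add: "integ m (\<lambda>x. f x + g x) = integ m f + integ m g"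
  by (simp add: integ_def algebra_simps sum.distrib)

lemma integ_diff: "integ m (\<lambda>x. f x - g x) = integ m f - integ m g"
  by (simp add: integ_def algebra_simps sum_subtractf)

lemma integ_cmult: "integ m (\<lambda>x. c * f x) = c * integ m f"
  by (simp add: integ_def sum_distrib_left mult.assoc)

lemma integ_const: "(\<Sum>x\<in>UNIV. m x) = 1 \<Longrightarrow> integ m (\<lambda>x. c) = c"
  by (simp add: integ_def flip: sum_distrib_left)

lemma integ_nonneg: "(\<And>x. 0 \<le> m x) \<Longrightarrow> (\<And>x. 0 \<le> f x) \<Longrightarrow> 0 \<le> integ m f"
  by (simp add: integ_def sum_nonneg)

text \<open>Nonnegativity of the variance of \<open>h\<close>.\<close>

lemma integ_sq_le:
  assumes m: "\<And>x. 0 \<le> m x" and 1: "(\<Sum>x\<in>UNIV. m x) = 1"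
  shows "(integ m h)\<^sup>2 \<le> integ m (\<lambda>x. (h x)\<^sup>2)"
proof -
  define c where "c = integ m h"
  have "0 \<le> integ m (\<lambda>x. (h x - c)\<^sup>2)"
    using m by (rule integ_nonneg) simp
  also have "(\<lambda>x. (h x - c)\<^sup>2) = (\<lambda>x. (h x)\<^sup>2 - 2 * c * h x + c\<^sup>2)"
    by (simp add: power2_diff algebra_simps)
  also have "integ m \<dots> = integ m (\<lambda>x. (h x)\<^sup>2) - 2 * c * c + c\<^sup>2"
    by (simp only: integ_add integ_diff integ_cmult integ_const[OF 1] c_def)
  finally show ?thesis
    by (simp add: c_def power2_eq_square)
qed

text \<open>Write \<open>h = c + k\<close> with mean \<open>c\<close>. The \<open>c\<^sup>2\<close>
  term vanishes as \<open>H\<close> has mean zero, and \<open>a\<close> controls the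
  \<open>k\<^sup>2\<close> term. AM-GM with free weight \<open>w\<close> splits the cross term: its
  \<open>k\<close> part is absorbed through \<open>w * b\<close>, its \<open>c\<close> part is the
  loss on the left.\<close>

lemma integ_potential_lower_bound:
  fixes L :: "'a::finite \<Rightarrow> 'a \<Rightarrow> real"
  assumes L: "Q_matrix L" "detailed_balance m L"
    and m: "\<And>x. 0 \<le> m x" and 1: "(\<Sum>x\<in>UNIV. m x) = 1"
    and H: "integ m H = 0"
    and a: "\<And>k. integ m k = 0 \<Longrightarrow> - integ m (\<lambda>x. H x * (k x)\<^sup>2) \<le> a * dirichlet_form m L k"
    and b: "\<And>k. integ m k = 0 \<Longrightarrow> (integ m (\<lambda>x. H x * k x))\<^sup>2 \<le> b * dirichlet_form m L k"
    and w: "0 < w" and l: "a + w * b \<le> l"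
  shows "- (integ m h)\<^sup>2 / w \<le> l * dirichlet_form m L h + integ m (\<lambda>x. H x * (h x)\<^sup>2)"
proof -
  define c where "c = integ m h"
  define k where "k = (\<lambda>x. h x - c)"
  define E where "E = dirichlet_form m L h"
  define y where "y = integ m (\<lambda>x. H x * k x)"
  have k0: "integ m k = 0"
    unfolding k_def by (simp add: integ_diff integ_const[OF 1] c_def)
  have Ek: "dirichlet_form m L k = E"
    unfolding k_def E_def by (rule dirichlet_form_shift[OF L])
  have E0: "0 \<le> E"
    unfolding E_def using L m by (rule dirichlet_form_nonneg)
  have "(\<lambda>x. H x * (h x)\<^sup>2) = (\<lambda>x. H x * (k x)\<^sup>2 + 2 * c * (H x * k x) + c\<^sup>2 * H x)"
    by (simp add: k_def power2_eq_square algebra_simps)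
  then have "integ m (\<lambda>x. H x * (h x)\<^sup>2) = integ m (\<lambda>x. H x * (k x)\<^sup>2) + 2 * c * y"
    by (simp only: integ_add integ_cmult H y_def)
  moreover have "- (2 * c * y) \<le> w * y\<^sup>2 + c\<^sup>2 / w"
  proof -
    have "0 \<le> (w * y + c)\<^sup>2 / w" using w by simp
    also have "\<dots> = w * y\<^sup>2 + c\<^sup>2 / w + 2 * c * y"
      using w by (simp add: field_simps power2_eq_square)
    finally show ?thesis by simp
  qed
  moreover have "w * y\<^sup>2 \<le> w * (b * E)"
    using b[OF k0] w by (simp add: y_def Ek)
  moreover have "(a + w * b) * E \<le> l * E"
    using l E0 by (rule mult_right_mono)
  ultimately show ?thesis
    using a[OF k0] by (simp add: Ek algebra_simps flip: E_def c_def)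
qed

section \<open>Evolution of the moments\<close>

text \<open>Makes derivatives within \<open>{a..}\<close> unique, also at \<open>a\<close>, where
  only right limits are available.\<close>

lemma at_within_atLeast_neq_bot:
  fixes a s :: real
  assumes "a \<le> s"
  shows "at s within {a..} \<noteq> bot"
proof
  assume bot: "at s within {a..} = bot"
  have "at_right s \<le> at s within {a..}"
    using assms by (intro at_le) auto
  with bot show False
    using trivial_limit_at_right_real[of s] by (simp add: bot_unique)
qed

context annealing_setting
begin

text \<open>\<open>H_deriv\<close> is a \<open>vector_derivative\<close>, so it has meaning only
  once differentiability is known. For \<open>Z\<close> this is not assumed; it follows since
  normalization forces \<open>Z\<close> to equal the differentiable sum \<open>S\<close> at
  nonnegative times.\<close>

lemma has_real_derivative_ln_\<mu>:
  assumes s: "0 \<le> s"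
  shows "((\<lambda>r. ln (\<mu> r x)) has_real_derivative - H_deriv \<mu> s x) (at s within {0..})"
proof -
  define S where "S r = (\<Sum>y\<in>UNIV. exp (- \<H> r y) * \<mu> 0 y)" for r
  have S_pos: "0 < S r" for r
    unfolding S_def using \<mu>_pos[of 0] by (intro sum_pos) auto
  have ZS: "Z r = S r" if r: "0 \<le> r" for r
  proof -
    have "1 = 1 / Z r * S r"
      using \<mu>_prob[OF r] \<mu>_eq[OF r] by (simp add: S_def sum_distrib_left)
    then show ?thesis by (cases "Z r = 0") (auto simp: field_simps)
  qed
  have ln_eq: "ln (\<mu> r x) = ln (\<mu> 0 x) - \<H> r x - ln (S r)" if r: "0 \<le> r" for r
  proof -
    have "\<mu> r x = exp (- \<H> r x) * \<mu> 0 x / S r"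
      using \<mu>_eq[OF r] ZS[OF r] by simp
    then show ?thesis
      using S_pos[of r] \<mu>_pos[of 0 x] by (simp add: ln_div ln_mult)
  qed
  obtain D where D: "\<And>y. ((\<lambda>r. \<H> r y) has_real_derivative D y) (at s within {0..})"
  proof -
    have "\<exists>d. ((\<lambda>r. \<H> r y) has_real_derivative d) (at s within {0..})" for y
      using \<H>_C1[of y] s by blast
    then show ?thesis using that by metis
  qed
  have "(S has_real_derivative (\<Sum>y\<in>UNIV. - D y * exp (- \<H> s y) * \<mu> 0 y)) (at s within {0..})"
    unfolding S_def
  proof (rule DERIV_sum)
    fix y
    show "((\<lambda>r. exp (- \<H> r y) * \<mu> 0 y) has_real_derivative - D y * exp (- \<H> s y) * \<mu> 0 y)
        (at s within {0..})"
      by (auto intro!: derivative_eq_intros D)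
  qed
  note S' = DERIV_chain2[OF DERIV_ln[OF S_pos] this]
  obtain D' where
    "((\<lambda>r. ln (\<mu> 0 x) - \<H> r x - ln (S r)) has_real_derivative D') (at s within {0..})"
    using DERIV_diff[OF DERIV_diff[OF DERIV_const D] S'] by (rule that)
  then have D': "((\<lambda>r. ln (\<mu> r x)) has_real_derivative D') (at s within {0..})"
    by (rule has_field_derivative_transform_within[where d = 1]) (use s in \<open>auto simp flip: ln_eq\<close>)
  have "at s within {0..} \<noteq> bot"
    using s by (rule at_within_atLeast_neq_bot)
  then have "vector_derivative (\<lambda>r. ln (\<mu> r x)) (at s within {0..}) = D'"
    using D' unfolding has_real_derivative_iff_has_vector_derivative
    by (rule vector_derivative_within)
  then show ?thesis
    using D' by (simp add: H_deriv_def)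
qed

lemma has_real_derivative_\<mu>:
  assumes s: "0 \<le> s"
  shows "((\<lambda>r. \<mu> r x) has_real_derivative - H_deriv \<mu> s x * \<mu> s x) (at s within {0..})"
proof -
  have "((\<lambda>r. exp (ln (\<mu> r x))) has_real_derivative - H_deriv \<mu> s x * \<mu> s x) (at s within {0..})"
    using DERIV_chain2[OF DERIV_exp has_real_derivative_ln_\<mu>[OF s, of x]] \<mu>_pos[OF s, of x]
    by (simp add: mult.commute)
  then show ?thesis
    by (rule has_field_derivative_transform_within[where d = 1]) (use s \<mu>_pos in auto)
qed

text \<open>Differentiate the constant total mass 1.\<close>

lemma integ_H_deriv:
  assumes s: "0 \<le> s"
  shows "integ (\<mu> s) (H_deriv \<mu> s) = 0"
proof -
  have "((\<lambda>r. \<Sum>x\<in>UNIV. \<mu> r x) has_real_derivative (\<Sum>x\<in>UNIV. - H_deriv \<mu> s x * \<mu> s x)) (at s within {0..})"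
    using has_real_derivative_\<mu>[OF s] by (intro DERIV_sum) auto
  then have "((\<lambda>r. 1) has_real_derivative (\<Sum>x\<in>UNIV. - H_deriv \<mu> s x * \<mu> s x)) (at s within {0..})"
    by (rule has_field_derivative_transform_within[where d = 1]) (use s \<mu>_prob in auto)
  moreover have "((\<lambda>r. 1) has_real_derivative 0) (at s within {0..})"
    by simp
  moreover have "at s within {0..} \<noteq> bot"
    using s by (rule at_within_atLeast_neq_bot)
  ultimately have "(\<Sum>x\<in>UNIV. - H_deriv \<mu> s x * \<mu> s x) = 0"
    using vector_derivative_unique_within has_real_derivative_iff_has_vector_derivative by blast
  then show ?thesis
    by (simp add: integ_def sum_negf)
qed

lemma \<mu>_nonneg: "0 \<le> s \<Longrightarrow> 0 \<le> \<mu> s x"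
  using \<mu>_pos less_imp_le by blast

text \<open>The centring argument with \<open>w = (r + 3) * t\<close> and
  \<open>l = 4 / r * lam s\<close>. The hypothesis, stated for \<open>p\<close>, thereby serves all
  smaller exponents above 1 as well.\<close>

lemma potential_lower_bound:
  assumes p: "1 < r" "r \<le> p" and t: "0 < t" and s: "0 \<le> s"
    and lam: "ereal (lam s) \<ge> ereal (p / 4) * const_A \<mu> \<L> s
                + ereal (p * (p + 3) / 4) * ereal t * const_B \<mu> \<L> s"
  shows "- (integ (\<mu> s) h)\<^sup>2 / ((r + 3) * t)
    \<le> 4 / r * lam s * dirichlet_form (\<mu> s) (\<L> s) h
      + integ (\<mu> s) (\<lambda>x. H_deriv \<mu> s x * (h x)\<^sup>2)"
proof -
  note L = \<L>_Q[OF s] \<L>_db[OF s] \<mu>_nonneg[OF s]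
  let ?E = "dirichlet_form (\<mu> s) (\<L> s)"
  have "\<exists>a b. 0 \<le> b \<and> p / 4 * a + p * (p + 3) / 4 * t * b \<le> lam s \<and>
    (\<forall>f\<in>mean_zero_nontrivial (\<mu> s).
       integ (\<mu> s) (\<lambda>x. - H_deriv \<mu> s x * (f x)\<^sup>2) \<le> a * ?E f \<and>
       \<bar>integ (\<mu> s) (\<lambda>x. H_deriv \<mu> s x * f x)\<bar>\<^sup>2 \<le> b * ?E f)"
  proof (rule sup0_divide_imp_real_bounds)
    show "ereal (p / 4) * sup0 ((\<lambda>f. ereal (integ (\<mu> s) (\<lambda>x. - H_deriv \<mu> s x * (f x)\<^sup>2)) / ereal (?E f))
            ` mean_zero_nontrivial (\<mu> s))
        + ereal (p * (p + 3) / 4 * t) * sup0 ((\<lambda>f. ereal (\<bar>integ (\<mu> s) (\<lambda>x. H_deriv \<mu> s x * f x)\<bar>\<^sup>2)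
            / ereal (?E f)) ` mean_zero_nontrivial (\<mu> s)) \<le> ereal (lam s)"
      using lam by (simp add: const_A_def const_B_def)
  qed (use p t dirichlet_form_nonneg[OF L] in auto)
  then obtain a b where b0: "0 \<le> b" and ab: "p / 4 * a + p * (p + 3) / 4 * t * b \<le> lam s"
    and K: "\<And>f. f \<in> mean_zero_nontrivial (\<mu> s) \<Longrightarrow>
       integ (\<mu> s) (\<lambda>x. - H_deriv \<mu> s x * (f x)\<^sup>2) \<le> a * ?E f \<and>
       \<bar>integ (\<mu> s) (\<lambda>x. H_deriv \<mu> s x * f x)\<bar>\<^sup>2 \<le> b * ?E f"
    by blast
  have K': "integ (\<mu> s) (\<lambda>x. - H_deriv \<mu> s x * (f x)\<^sup>2) \<le> a * ?E f \<and>
       \<bar>integ (\<mu> s) (\<lambda>x. H_deriv \<mu> s x * f x)\<bar>\<^sup>2 \<le> b * ?E f" if "integ (\<mu> s) f = 0" for f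
  proof (cases "f = (\<lambda>x. 0)")
    case True
    then show ?thesis by (simp add: integ_def dirichlet_form_def)
  next
    case False
    with that K show ?thesis by (simp add: mean_zero_nontrivial_def)
  qed
  define Y where "Y = a + (r + 3) * t * b"
  have "p / 4 * Y \<le> p / 4 * a + p * (p + 3) / 4 * t * b"
  proof -
    have "(r + 3) * (p / 4 * t * b) \<le> (p + 3) * (p / 4 * t * b)"
      using p t b0 by (intro mult_right_mono) auto
    then show ?thesis by (simp add: Y_def algebra_simps)
  qed
  with ab have Y: "p / 4 * Y \<le> lam s" by linarith
  \<comment> \<open>As \<open>a\<close> may be negative, so may \<open>Y\<close>. Then replacing
    \<open>p\<close> by \<open>r\<close> goes the wrong way, and positivity of \<open>lam s\<close>
    is used instead.\<close>
  have "r / 4 * Y \<le> lam s"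
  proof (cases "0 \<le> Y")
    case True
    then have "r / 4 * Y \<le> p / 4 * Y" using p by (intro mult_right_mono) auto
    with Y show ?thesis by simp
  next
    case False
    then have "r / 4 * Y \<le> 0" using p by (intro mult_nonneg_nonpos) auto
    with lam_pos[OF s] show ?thesis by simp
  qed
  then have "Y \<le> 4 / r * lam s"
    using p by (simp add: field_simps)
  then show ?thesis
    using K' p t unfolding Y_def
    by (intro integ_potential_lower_bound[OF L \<mu>_prob[OF s] integ_H_deriv[OF s], where a = a and b = b])
      (auto simp: integ_def sum_negf)
qed

end

section \<open>Monotonicity and elementary real inequalities\<close>

text \<open>Derivatives are one-sided at the ends, so they are used in the open interval only;
  continuity reaches the end points.\<close>

lemma nonneg_derivative_within_imp_le:
  fixes F :: "real \<Rightarrow> real"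
  assumes s: "s \<in> {0..t}"
    and D: "\<And>r. r \<in> {0..t} \<Longrightarrow> \<exists>D. (F has_real_derivative D) (at r within {0..t}) \<and> 0 \<le> D"
  shows "F s \<le> F t"
proof (rule DERIV_nonneg_imp_increasing_open[where f = F])
  show "s \<le> t" using s by simp
  show "\<exists>D. (F has_real_derivative D) (at r) \<and> 0 \<le> D" if "s < r" "r < t" for r
    using D[of r] that s by (auto simp: at_within_Icc_at)
  have "continuous_on {0..t} F"
    unfolding continuous_on_eq_continuous_within using D DERIV_continuous by blast
  then show "continuous_on {s..t} F"
    using s by (auto intro: continuous_on_subset)
qed

text \<open>In \<open>x powr p = x * x powr (p - 1)\<close> the second factor is monotone. This
  later turns a sum of \<open>p\<close>-th powers into a sum of norms.\<close>

lemma add_powr_le: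
  fixes a c p :: real
  assumes "0 \<le> a" "0 \<le> c" "1 \<le> p"
  shows "a powr p + c powr p \<le> (a + c) powr p"
proof -
  have split: "x powr p = x * x powr (p - 1)" if "0 \<le> x" for x :: real
    using that by (cases "x = 0") (auto simp: powr_diff)
  have "a * a powr (p - 1) + c * c powr (p - 1) \<le> a * (a + c) powr (p - 1) + c * (a + c) powr (p - 1)"
    using assms by (intro add_mono mult_left_mono powr_mono2) auto
  then show ?thesis
    using assms by (simp add: split distrib_right)
qed

text \<open>The source of \<open>2 powr (1 / 4)\<close>: the \<open>r\<close>-th root of the growth
  factor has a bound independent of \<open>r\<close>.\<close>

lemma exp_growth_le:
  fixes r :: real
  assumes "1 \<le> r"
  shows "exp ((r - 1) / (r + 3)) \<le> 2 powr (r / 4)"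
proof -
  \<comment> \<open>The difference of the two sides is
    \<open>(r - 3/2)\<^sup>2 + 15/4\<close>.\<close>
  have "6 * (r - 1) \<le> r * (r + 3)"
    using sum_power2_ge_zero[of "r - 3/2" 0] by (simp add: power2_eq_square algebra_simps)
  then have "(r - 1) / (r + 3) \<le> r / 6"
    using assms by (simp add: field_simps)
  also have "\<dots> \<le> r / 4 * ln 2"
    using ln2_ge_two_thirds assms by simp
  finally show ?thesis by (simp add: powr_def)
qed

context annealing_setting
begin

text \<open>The potential enters with factor \<open>r\<close> through the solution and
  \<open>-1\<close> through the measure, leaving \<open>r - 1\<close>. Stroock--Varopoulos gives the
  generator term the same factor, so the bracket of \<open>potential_lower_bound\<close>
  appears.\<close>

lemma moment_derivative:
  assumes r: "1 < r" "r \<le> p" and t: "0 < t" and s: "s \<in> {0..t}"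
    and lam: "ereal (lam s) \<ge> ereal (p / 4) * const_A \<mu> \<L> s
                + ereal (p * (p + 3) / 4) * ereal t * const_B \<mu> \<L> s"
    and u: "backward_solution \<mu> \<L> lam t f u"
  shows "\<exists>D. ((\<lambda>s. integ (\<mu> s) (\<lambda>x. \<bar>u s x\<bar> powr r)) has_real_derivative D) (at s within {0..t}) \<and>
    - ((r - 1) / ((r + 3) * t)) * (integ (\<mu> s) (\<lambda>x. \<bar>u s x\<bar> powr (r/2)))\<^sup>2 \<le> D"
proof -
  have s0: "0 \<le> s" using s by simp
  note L = \<L>_Q[OF s0] \<L>_db[OF s0] \<mu>_nonneg[OF s0]
  define h where "h = (\<lambda>x. \<bar>u s x\<bar> powr (r/2))"
  define g where "g = (\<lambda>x. signed_powr (r - 1) (u s x))"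
  define G where "G = gen_apply (\<L> s) (u s)"
  define H where "H = H_deriv \<mu> s"
  define E where "E = dirichlet_form (\<mu> s) (\<L> s) h"
  define D where "D = (\<Sum>x\<in>UNIV. r * g x * (- (lam s * G x - H x * u s x)) * \<mu> s x
      + - H x * \<mu> s x * \<bar>u s x\<bar> powr r)"
  have ug: "u s x * g x = \<bar>u s x\<bar> powr r" for x
    unfolding g_def by (rule mult_signed_powr)
  have h2: "(h x)\<^sup>2 = \<bar>u s x\<bar> powr r" for x
    by (simp add: h_def power2_eq_square flip: powr_add)
  have "((\<lambda>s. integ (\<mu> s) (\<lambda>x. \<bar>u s x\<bar> powr r)) has_real_derivative D) (at s within {0..t})"
    unfolding integ_def D_def
  proof (intro DERIV_sum DERIV_mult')
    fix x
    have "((\<lambda>s. u s x) has_real_derivative - (lam s * G x - H x * u s x)) (at s within {0..t})"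
      using u s by (simp add: backward_solution_def G_def H_def)
    then have U: "((\<lambda>s. \<bar>u s x\<bar> powr r) has_real_derivative r * g x * (- (lam s * G x - H x * u s x)))
        (at s within {0..t})"
      unfolding g_def by (rule DERIV_chain2[OF has_real_derivative_abs_powr[OF r(1)]])
    have M: "((\<lambda>s. \<mu> s x) has_real_derivative - H x * \<mu> s x) (at s within {0..t})"
      using has_real_derivative_\<mu>[OF s0] unfolding H_def
      by (rule has_field_derivative_subset) auto
    show "((\<lambda>s. \<bar>u s x\<bar> powr r * \<mu> s x) has_real_derivative
        r * g x * (- (lam s * G x - H x * u s x)) * \<mu> s x + - H x * \<mu> s x * \<bar>u s x\<bar> powr r)
        (at s within {0..t})"
      using U M by (rule DERIV_mult)
  qed
  moreover have "- ((r - 1) / ((r + 3) * t)) * (integ (\<mu> s) h)\<^sup>2 \<le> D"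
  proof -
    have "r * g x * (- (lam s * G x - H x * u s x)) * \<mu> s x + - H x * \<mu> s x * \<bar>u s x\<bar> powr r
        = (r - 1) * (H x * (h x)\<^sup>2 * \<mu> s x) - r * lam s * (g x * G x * \<mu> s x)" for x
      by (simp add: algebra_simps h2 flip: ug)
    then have D: "D = (r - 1) * integ (\<mu> s) (\<lambda>x. H x * (h x)\<^sup>2)
        + r * lam s * (- integ (\<mu> s) (\<lambda>x. g x * G x))"
      unfolding D_def integ_def by (simp add: sum_subtractf sum_distrib_left)
    have "(r - 1) * (4 / r * lam s * E) = r * lam s * (4 * (r - 1) / r\<^sup>2 * E)"
      using r by (simp add: field_simps power2_eq_square)
    also have "\<dots> \<le> r * lam s * (- integ (\<mu> s) (\<lambda>x. g x * G x))"
      using dirichlet_form_Stroock_Varopoulos[OF L r(1), of "u s"] r lam_pos[OF s0]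
      unfolding E_def h_def g_def G_def by (intro mult_left_mono) auto
    finally have "(r - 1) * (4 / r * lam s * E + integ (\<mu> s) (\<lambda>x. H x * (h x)\<^sup>2)) \<le> D"
      by (simp add: D distrib_left)
    moreover have "(r - 1) * (- (integ (\<mu> s) h)\<^sup>2 / ((r + 3) * t))
        \<le> (r - 1) * (4 / r * lam s * E + integ (\<mu> s) (\<lambda>x. H x * (h x)\<^sup>2))"
      using potential_lower_bound[OF r t s0 lam, of h] r
      unfolding E_def H_def by (intro mult_left_mono) auto
    ultimately show ?thesis by simp
  qed
  ultimately show ?thesis
    unfolding h_def by blast
qed

end

section \<open>Bounds on the moments\<close>

text \<open>Here \<open>t\<close> is positive because the AM-GM weight \<open>(r + 3) * t\<close>
  occurs as a divisor.\<close>

locale annealing_bound = annealing_setting \<mu> Z \<H> \<L> lam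
  for \<mu> :: "real \<Rightarrow> 'a::finite \<Rightarrow> real" and Z \<H> \<L> lam +
  fixes t p :: real and f :: "'a::finite \<Rightarrow> real" and u :: "real \<Rightarrow> 'a \<Rightarrow> real"
  assumes t: "0 < t" and p: "2 \<le> p"
    and u: "backward_solution \<mu> \<L> lam t f u"
    and lam: "\<And>s. s \<in> {0..t} \<Longrightarrow> ereal (lam s) \<ge> ereal (p / 4) * const_A \<mu> \<L> s
                + ereal (p * (p + 3) / 4) * ereal t * const_B \<mu> \<L> s"
begin

definition moment :: "real \<Rightarrow> real \<Rightarrow> real" where
  "moment r s = integ (\<mu> s) (\<lambda>x. \<bar>u s x\<bar> powr r)"

lemma moment_nonneg: "s \<in> {0..t} \<Longrightarrow> 0 \<le> moment r s"
  unfolding moment_def using \<mu>_nonneg by (intro integ_nonneg) auto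

lemma Lp_norm_eq: "Lp_norm r (\<mu> s) (u s) = moment r s powr (1 / r)"
  by (simp add: Lp_norm_def moment_def integ_def)

lemma has_real_derivative_moment:
  assumes "1 < r" "r \<le> p" "s \<in> {0..t}"
  obtains D where "(moment r has_real_derivative D) (at s within {0..t})"
    "- ((r - 1) / ((r + 3) * t)) * (moment (r/2) s)\<^sup>2 \<le> D"
  using moment_derivative[OF assms(1,2) t assms(3) lam[OF assms(3)] u]
  unfolding moment_def[abs_def] by blast

lemma moment_half_sq_le:
  assumes s: "s \<in> {0..t}"
  shows "(moment (r/2) s)\<^sup>2 \<le> moment r s"
proof -
  have "(moment (r/2) s)\<^sup>2 \<le> integ (\<mu> s) (\<lambda>x. (\<bar>u s x\<bar> powr (r/2))\<^sup>2)"
    unfolding moment_def using s \<mu>_nonneg \<mu>_prob by (intro integ_sq_le) auto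
  also have "\<dots> = moment r s"
    by (simp add: moment_def power2_eq_square flip: powr_add)
  finally show ?thesis .
qed

text \<open>Gronwall from the right end: \<open>exp (\<kappa> * s) * moment r s\<close> is
  nondecreasing in \<open>s\<close>, and the integrating factor is at least 1.\<close>

lemma moment_exp_bound_gt_1:
  assumes r: "1 < r" "r \<le> p" and s: "s \<in> {0..t}"
  shows "moment r s \<le> exp ((r - 1) / (r + 3)) * moment r t"
proof -
  define \<kappa> where "\<kappa> = (r - 1) / ((r + 3) * t)"
  have \<kappa>: "0 \<le> \<kappa>" "\<kappa> * t = (r - 1) / (r + 3)"
    using r t by (auto simp: \<kappa>_def)
  have "exp (\<kappa> * s) * moment r s \<le> exp (\<kappa> * t) * moment r t"
  proof (rule nonneg_derivative_within_imp_le[OF s])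
    fix s assume s: "s \<in> {0..t}"
    obtain D where D: "(moment r has_real_derivative D) (at s within {0..t})"
      "- \<kappa> * (moment (r/2) s)\<^sup>2 \<le> D"
      using has_real_derivative_moment[OF r s] unfolding \<kappa>_def .
    have "((\<lambda>s. exp (\<kappa> * s) * moment r s) has_real_derivative exp (\<kappa> * s) * (\<kappa> * moment r s + D))
        (at s within {0..t})"
      by (auto intro!: derivative_eq_intros D(1) simp: algebra_simps)
    moreover have "0 \<le> \<kappa> * moment r s + D"
      using D(2) mult_left_mono[OF moment_half_sq_le[OF s] \<kappa>(1), of r] by linarith
    ultimately show "\<exists>D. ((\<lambda>s. exp (\<kappa> * s) * moment r s) has_real_derivative D) (at s within {0..t}) \<and> 0 \<le> D"
      by (metis exp_ge_zero mult_nonneg_nonneg)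
  qed
  moreover have "1 * moment r s \<le> exp (\<kappa> * s) * moment r s"
    using \<kappa> s moment_nonneg[OF s] by (intro mult_right_mono) auto
  ultimately show ?thesis
    by (simp add: \<kappa>(2))
qed

lemma tendsto_moment:
  "(\<lambda>r. moment r s) \<midarrow>r0\<rightarrow> moment r0 s"
proof -
  have "(\<lambda>r. \<bar>u s x\<bar> powr r) \<midarrow>r0\<rightarrow> \<bar>u s x\<bar> powr r0" for x
    \<comment> \<open>Where \<open>u s x = 0\<close>, the power is 0 for every exponent, as
      \<open>0 powr r = 0\<close> even for \<open>r = 0\<close>.\<close>
    by (cases "u s x = 0") (auto intro!: tendsto_intros)
  then show ?thesis
    unfolding moment_def integ_def by (intro tendsto_sum tendsto_mult tendsto_const)
qed

text \<open>The exponent 1, needed as \<open>p/2\<close> when \<open>p = 2\<close>, cannot be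
  differentiated directly, the modulus having a kink at 0. It is reached by letting \<open>r\<close>
  decrease to 1.\<close>

lemma moment_exp_bound:
  assumes r: "1 \<le> r" "r \<le> p" and s: "s \<in> {0..t}"
  shows "moment r s \<le> exp ((r - 1) / (r + 3)) * moment r t"
proof (cases "r = 1")
  case False
  then show ?thesis using moment_exp_bound_gt_1 r s by simp
next
  case True
  have T: "((\<lambda>r. moment r s) \<longlongrightarrow> moment 1 s) (at_right 1)" for s
    using tendsto_moment by (rule tendsto_mono[rotated]) (simp add: at_le)
  have "moment 1 s \<le> exp ((1 - 1) / (1 + 3)) * moment 1 t"
  proof (rule tendsto_le[OF _ _ T])
    show "((\<lambda>r. exp ((r - 1) / (r + 3)) * moment r t) \<longlongrightarrow> exp ((1 - 1) / (1 + 3)) * moment 1 t) (at_right 1)"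
      by (intro tendsto_intros T) auto
    have "\<forall>\<^sub>F r in at_right 1. r \<in> {1<..<p}"
      using p by (intro eventually_at_rightI) auto
    then show "\<forall>\<^sub>F r in at_right 1. moment r s \<le> exp ((r - 1) / (r + 3)) * moment r t"
      by eventually_elim (use moment_exp_bound_gt_1 s in auto)
  qed simp
  with True show ?thesis by simp
qed

lemma moment_bound:
  assumes r: "1 \<le> r" "r \<le> p" and s: "s \<in> {0..t}"
  shows "moment r s \<le> 2 powr (r / 4) * moment r t"
proof -
  have "exp ((r - 1) / (r + 3)) * moment r t \<le> 2 powr (r / 4) * moment r t"
    using exp_growth_le[OF r(1)] moment_nonneg[of t r] t by (intro mult_right_mono) auto
  with moment_exp_bound[OF assms] show ?thesis by simp
qed

text \<open>With the lower moment bounded by \<open>M\<close>, direct integration replaces Gronwall,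
  so the terminal moment keeps the factor 1. The accumulated loss is
  \<open>\<kappa> * (t - s) * M\<^sup>2\<close>, and \<open>\<kappa> * t \<le> 1\<close>.\<close>

lemma moment_additive_bound:
  assumes s: "s \<in> {0..t}" and M: "\<And>s. s \<in> {0..t} \<Longrightarrow> moment (p/2) s \<le> M"
  shows "moment p s \<le> moment p t + M\<^sup>2"
proof -
  define \<kappa> where "\<kappa> = (p - 1) / ((p + 3) * t)"
  have \<kappa>: "0 \<le> \<kappa>" "\<kappa> * t \<le> 1"
    using p t by (auto simp: \<kappa>_def)
  have "moment p s + \<kappa> * M\<^sup>2 * s \<le> moment p t + \<kappa> * M\<^sup>2 * t"
  proof (rule nonneg_derivative_within_imp_le[OF s])
    fix s assume s: "s \<in> {0..t}"
    obtain D where D: "(moment p has_real_derivative D) (at s within {0..t})"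
      "- \<kappa> * (moment (p/2) s)\<^sup>2 \<le> D"
      using has_real_derivative_moment[of p s] p s unfolding \<kappa>_def by auto
    have "((\<lambda>s. moment p s + \<kappa> * M\<^sup>2 * s) has_real_derivative D + \<kappa> * M\<^sup>2) (at s within {0..t})"
      by (auto intro!: derivative_eq_intros D(1))
    moreover have "\<kappa> * (moment (p/2) s)\<^sup>2 \<le> \<kappa> * M\<^sup>2"
      using M[OF s] moment_nonneg[OF s] \<kappa>(1) by (intro mult_left_mono power_mono) auto
    ultimately show "\<exists>D. ((\<lambda>s. moment p s + \<kappa> * M\<^sup>2 * s) has_real_derivative D) (at s within {0..t}) \<and> 0 \<le> D"
      using D(2) by (intro exI[of _ "D + \<kappa> * M\<^sup>2"]) auto
  qed
  moreover have "0 \<le> \<kappa> * M\<^sup>2 * s"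
    using \<kappa> s by simp
  moreover have "\<kappa> * t * M\<^sup>2 \<le> M\<^sup>2"
    using \<kappa> t by (intro mult_left_le_one_le) auto
  ultimately show ?thesis by (simp add: mult.commute mult.left_commute)
qed

lemma Lp_norm_bound:
  assumes s: "s \<in> {0..t}"
  shows "Lp_norm p (\<mu> s) (u s) \<le> 2 powr (1 / 4) * Lp_norm p (\<mu> t) (u t)"
proof -
  have "moment p s powr (1 / p) \<le> (2 powr (p / 4) * moment p t) powr (1 / p)"
    using moment_bound[of p s] moment_nonneg[OF s] p s by (intro powr_mono2) auto
  also have "\<dots> = 2 powr (1 / 4) * moment p t powr (1 / p)"
    using p moment_nonneg[of t p] t by (simp add: powr_mult powr_powr)
  finally show ?thesis by (simp add: Lp_norm_eq)
qed

text \<open>The \<open>p\<close>-th powers of the two terms on the right are the terminal moment and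
  \<open>M\<^sup>2\<close>, so superadditivity of the power finishes the additive moment
  bound.\<close>

lemma Lp_norm_additive_bound:
  assumes s: "s \<in> {0..t}"
  shows "Lp_norm p (\<mu> s) (u s) \<le> Lp_norm p (\<mu> t) (u t) + 2 powr (1 / 4) * Lp_norm (p/2) (\<mu> t) (u t)"
proof -
  define M where "M = 2 powr (p/2 / 4) * moment (p/2) t"
  define a c where "a = Lp_norm p (\<mu> t) (u t)" and "c = 2 powr (1 / 4) * Lp_norm (p/2) (\<mu> t) (u t)"
  have nonneg: "0 \<le> a" "0 \<le> c" "0 \<le> moment p t" "0 \<le> moment (p/2) t"
    using moment_nonneg[of t] t by (auto simp: a_def c_def Lp_norm_def)
  have a: "a powr p = moment p t"
    using p nonneg by (simp add: a_def Lp_norm_eq powr_powr)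
  have c: "c powr p = M\<^sup>2"
  proof -
    have "c powr p = 2 powr (p / 4) * moment (p/2) t powr 2"
      using p nonneg by (simp add: c_def Lp_norm_eq powr_mult powr_powr)
    also have "\<dots> = M\<^sup>2"
      using nonneg by (simp add: M_def power_mult_distrib power2_eq_square flip: powr_add)
    finally show ?thesis .
  qed
  have "moment p s \<le> moment p t + M\<^sup>2"
    using s moment_bound[of "p/2"] p unfolding M_def by (intro moment_additive_bound) auto
  also have "\<dots> \<le> (a + c) powr p"
    using add_powr_le[of a c p] nonneg p by (simp add: a c)
  finally have "moment p s powr (1 / p) \<le> ((a + c) powr p) powr (1 / p)"
    using p moment_nonneg[OF s] by (intro powr_mono2) auto
  also have "\<dots> = a + c"
    using p nonneg by (simp add: powr_powr)
  finally show ?thesis by (simp add: Lp_norm_eq a_def c_def)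
qed

end

theorem theorem6:
  fixes \<mu> :: "real \<Rightarrow> 'a::finite \<Rightarrow> real"
    and Z :: "real \<Rightarrow> real"
    and \<H> :: "real \<Rightarrow> 'a \<Rightarrow> real"
    and \<L> :: "real \<Rightarrow> 'a \<Rightarrow> 'a \<Rightarrow> real"
    and lam :: "real \<Rightarrow> real"
    and q :: "real \<Rightarrow> real \<Rightarrow> ('a \<Rightarrow> real) \<Rightarrow> 'a \<Rightarrow> real"
    and t p :: real
  assumes "annealing_setting \<mu> Z \<H> \<L> lam"
    and "\<And>r g. 0 \<le> r \<Longrightarrow> backward_solution \<mu> \<L> lam r g (\<lambda>s. q s r g)"
    and "0 \<le> t" and "2 \<le> p"
    and "\<And>s. s \<in> {0..t} \<Longrightarrow>
           ereal (lam s) \<ge> ereal (p / 4) * const_A \<mu> \<L> s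
                           + ereal (p * (p + 3) / 4) * ereal t * const_B \<mu> \<L> s"
  shows "\<forall>s\<in>{0..t}. \<forall>f.
           Lp_norm p (\<mu> s) (q s t f) \<le> 2 powr (1 / 4) * Lp_norm p (\<mu> t) f \<and>
           Lp_norm p (\<mu> s) (q s t f) \<le> Lp_norm p (\<mu> t) f + 2 powr (1 / 4) * Lp_norm (p / 2) (\<mu> t) f"
proof (intro ballI allI)
  fix s f assume s: "s \<in> {0..t}"
  have u: "backward_solution \<mu> \<L> lam t f (\<lambda>s. q s t f)"
    using assms(2,3) by blast
  then have qt: "q t t f = f" by (simp add: backward_solution_def)
  show "Lp_norm p (\<mu> s) (q s t f) \<le> 2 powr (1 / 4) * Lp_norm p (\<mu> t) f \<and>
      Lp_norm p (\<mu> s) (q s t f) \<le> Lp_norm p (\<mu> t) f + 2 powr (1 / 4) * Lp_norm (p / 2) (\<mu> t) f"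
  proof (cases "t = 0")
    \<comment> \<open>Now \<open>s = t\<close> and the solution is \<open>f\<close> itself; the
      first bound holds as \<open>2 powr (1 / 4) \<ge> 1\<close>, the second as norms are
      nonnegative.\<close>
    case True
    have nonneg: "0 \<le> Lp_norm r m g" for r and m g :: "'a \<Rightarrow> real"
      by (simp add: Lp_norm_def)
    have "1 * Lp_norm p (\<mu> t) f \<le> 2 powr (1 / 4) * Lp_norm p (\<mu> t) f"
      using nonneg by (intro mult_right_mono) (auto simp: ge_one_powr_ge_zero)
    with True s qt nonneg show ?thesis by simp
  next
    case False
    interpret annealing_setting \<mu> Z \<H> \<L> lam by fact
    interpret annealing_bound \<mu> Z \<H> \<L> lam t p f "\<lambda>s. q s t f"
      by unfold_locales (use False assms(3-5) u in auto)
    show ?thesis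
      using Lp_norm_bound[OF s] Lp_norm_additive_bound[OF s] by (simp add: qt)
  qed
qed

end
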